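(* For any data symmetry $(\mathbb{D},G)$ the following are equivalent: (1) for every finite $E\subseteq\mathbb{D}$ and all $c,d\in\mathbb{D}\setminus E$ with $c\neq d$, $$c\cdot G_E\subseteq c\cdot\big(G_{E\cup\{c\}}+G_{E\cup\{d\}}\big);$$ (2) for every subgroup $H\le G$ and all finite $C,D\subseteq\mathbb{D}$, if $G_C\le H$ and $G_D\le H$ then $G_{C\cap D}\le H$ (equivalently, $(\mathbb{D},G)$ admits least supports).
   Context: A data symmetry $(\mathbb{D},G)$ is a set $\mathbb{D}$ together with a subgroup $G$ of the group of all bijections of $\mathbb{D}$. For $C\subseteq\mathbb{D}$, $G_C=\{\pi\in G:\pi(c)=c\ \forall c\in C\}$. For subgroups $H,K\le G$, $H+K$ is the subgroup of $G$ generated by $H\cup K$. For $c\in\mathbb{D}$ and $H\le G$, $c\cdot H=\{\pi(c):\pi\in H\}$. $(\mathbb{D},G)$ admits least supports if every element of every nominal $G$-set has a least (w.r.t. inclusion) finite support, where $C\subseteq\mathbb{D}$ supports $x$ if $x\cdot\pi=x$ for all $\pi\in G_C$, and a $G$-set is nominal if all its elements have finite supports. *)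

theory Defs
  imports "HOL-Algebra.Group_Action" "HOL-Algebra.Generated_Groups"
begin

text \<open>
  \<^const>\<open>BijGroup\<close> is the group of all bijections of a set, its elements being normalised to
  be \<^const>\<open>extensional\<close>; its multiplication is \<open>g \<otimes> f = g \<circ> f\<close>.
\<close>

definition data_symmetry :: "'d set \<Rightarrow> ('d \<Rightarrow> 'd) set \<Rightarrow> bool" where
  "data_symmetry DD G \<longleftrightarrow> subgroup G (BijGroup DD)"

definition symmetry_group :: "'d set \<Rightarrow> ('d \<Rightarrow> 'd) set \<Rightarrow> ('d \<Rightarrow> 'd) monoid" where
  "symmetry_group DD G = (BijGroup DD)\<lparr>carrier := G\<rparr>"

definition fixing :: "('d \<Rightarrow> 'd) set \<Rightarrow> 'd set \<Rightarrow> ('d \<Rightarrow> 'd) set" where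
  "fixing G C = {\<pi> \<in> G. \<forall>c\<in>C. \<pi> c = c}"

definition subgroup_join ::
  "'d set \<Rightarrow> ('d \<Rightarrow> 'd) set \<Rightarrow> ('d \<Rightarrow> 'd) set \<Rightarrow> ('d \<Rightarrow> 'd) set \<Rightarrow> ('d \<Rightarrow> 'd) set" where
  "subgroup_join DD G H K = generate (symmetry_group DD G) (H \<union> K)"

definition data_orbit :: "'d \<Rightarrow> ('d \<Rightarrow> 'd) set \<Rightarrow> 'd set" where
  "data_orbit c H = {\<pi> c | \<pi>. \<pi> \<in> H}"

definition orbit_condition :: "'d set \<Rightarrow> ('d \<Rightarrow> 'd) set \<Rightarrow> bool" where
  "orbit_condition DD G \<longleftrightarrow>
     (\<forall>E c d. finite E \<and> E \<subseteq> DD \<and> c \<in> DD - E \<and> d \<in> DD - E \<and> c \<noteq> d \<longrightarrow>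
        data_orbit c (fixing G E) \<subseteq>
          data_orbit c (subgroup_join DD G (fixing G (E \<union> {c})) (fixing G (E \<union> {d}))))"

definition intersection_condition :: "'d set \<Rightarrow> ('d \<Rightarrow> 'd) set \<Rightarrow> bool" where
  "intersection_condition DD G \<longleftrightarrow>
     (\<forall>H C D. subgroup H (symmetry_group DD G) \<and>
        finite C \<and> C \<subseteq> DD \<and> finite D \<and> D \<subseteq> DD \<and>
        fixing G C \<subseteq> H \<and> fixing G D \<subseteq> H \<longrightarrow> fixing G (C \<inter> D) \<subseteq> H)"

text \<open>
  A \<open>G\<close>-set is a set \<open>X\<close> with an action \<open>\<phi>\<close>, where \<open>x \<cdot> \<pi>\<close> is \<open>\<phi> \<pi> x\<close>. The action is written
  on the right and products of bijections are read from left to right, as in \<open>c \<cdot> \<pi> = \<pi> c\<close>, so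
  \<open>x \<cdot> (\<pi>\<sigma>) = (x \<cdot> \<pi>) \<cdot> \<sigma>\<close> says \<open>\<phi> (\<sigma> \<circ> \<pi>) = \<phi> \<sigma> \<circ> \<phi> \<pi>\<close>: exactly the homomorphism law of
  \<^const>\<open>group_action\<close> for \<^const>\<open>BijGroup\<close>.
\<close>

definition supports ::
  "'d set \<Rightarrow> ('d \<Rightarrow> 'd) set \<Rightarrow> (('d \<Rightarrow> 'd) \<Rightarrow> 'x \<Rightarrow> 'x) \<Rightarrow> 'd set \<Rightarrow> 'x \<Rightarrow> bool" where
  "supports DD G \<phi> C x \<longleftrightarrow> C \<subseteq> DD \<and> (\<forall>\<pi> \<in> fixing G C. \<phi> \<pi> x = x)"

definition nominal_set ::
  "'d set \<Rightarrow> ('d \<Rightarrow> 'd) set \<Rightarrow> 'x set \<Rightarrow> (('d \<Rightarrow> 'd) \<Rightarrow> 'x \<Rightarrow> 'x) \<Rightarrow> bool" where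
  "nominal_set DD G X \<phi> \<longleftrightarrow>
     group_action (symmetry_group DD G) X \<phi> \<and>
     (\<forall>x\<in>X. \<exists>C. finite C \<and> supports DD G \<phi> C x)"

definition least_finite_support ::
  "'d set \<Rightarrow> ('d \<Rightarrow> 'd) set \<Rightarrow> (('d \<Rightarrow> 'd) \<Rightarrow> 'x \<Rightarrow> 'x) \<Rightarrow> 'd set \<Rightarrow> 'x \<Rightarrow> bool" where
  "least_finite_support DD G \<phi> C x \<longleftrightarrow>
     finite C \<and> supports DD G \<phi> C x \<and>
     (\<forall>C'. finite C' \<and> supports DD G \<phi> C' x \<longrightarrow> C \<subseteq> C')"

text \<open>
  HOL cannot quantify over types inside a formula, so the type \<open>'x\<close> of which the nominal sets are
  subsets is a parameter. The type \<open>('d \<Rightarrow> 'd) set\<close> contains all cosets of subgroups of \<open>G\<close>,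
  hence an isomorphic copy of every single-orbit \<open>G\<close>-set.
\<close>

definition admits_least_supports :: "'x itself \<Rightarrow> 'd set \<Rightarrow> ('d \<Rightarrow> 'd) set \<Rightarrow> bool" where
  "admits_least_supports (_ :: 'x itself) DD G \<longleftrightarrow>
     (\<forall>(X :: 'x set) \<phi>. nominal_set DD G X \<phi> \<longrightarrow>
        (\<forall>x\<in>X. \<exists>C. least_finite_support DD G \<phi> C x))"

end

theory Submission
  imports Defs "HOL-Algebra.Left_Coset"
begin

text \<open>
  The orbit condition at \<open>E, c, d\<close> says exactly that \<open>G\<^sub>E\<close> is generated by \<open>G\<^bsub>E \<union> {c}\<^esub>\<close> and
  \<open>G\<^bsub>E \<union> {d}\<^esub>\<close>: if \<open>\<pi> \<in> G\<^sub>E\<close> moves \<open>c\<close> as some \<open>\<tau>\<close> of the join does, then \<open>\<tau>\<^sup>-\<^sup>1\<pi>\<close> fixes \<open>c\<close>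
  as well. This is the intersection condition for \<open>C\<close> and \<open>D\<close> that exceed \<open>C \<inter> D\<close> by one point each,
  and the general case follows by induction on the size of the symmetric difference.
  A set supports \<open>x\<close> iff its fixing group lies in the stabilizer of \<open>x\<close>, and every
  subgroup \<open>H\<close> is the stabilizer of the point \<open>H\<close> of the \<open>G\<close>-set of left cosets of \<open>H\<close>; hence the
  intersection condition amounts to closure of finite supports under intersection.
\<close>

section \<open>Reduction to one-point extensions\<close>

text \<open>Applied below with \<open>fixing G C \<subseteq> H\<close> as \<open>P C\<close>. If
  \<open>C - D\<close> has a point besides \<open>c\<close>, the pairs
  \<open>(C, insert c D)\<close> and \<open>(insert c (C \<inter> D), D)\<close> both have a smaller
  symmetric difference. When neither this nor its mirror image is possible, the two sets are
  comparable or exactly as in \<open>step\<close>.\<close>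

lemma Int_closed_from_insert:
  assumes mono: "\<And>C D. P C \<Longrightarrow> C \<subseteq> D \<Longrightarrow> finite D \<Longrightarrow> D \<subseteq> A \<Longrightarrow> P D"
    and step: "\<And>E c d. finite E \<Longrightarrow> E \<subseteq> A \<Longrightarrow> c \<in> A - E \<Longrightarrow> d \<in> A - E \<Longrightarrow> c \<noteq> d \<Longrightarrow>
                 P (insert c E) \<Longrightarrow> P (insert d E) \<Longrightarrow> P E"
    and "finite C" "C \<subseteq> A" "finite D" "D \<subseteq> A" "P C" "P D"
  shows "P (C \<inter> D)"
  using assms(3-)
proof (induction "card (C - D) + card (D - C)" arbitrary: C D rule: less_induct)
  case less
  \<comment> \<open>Enlarging \<open>D\<close> by \<open>c \<in> C - D\<close> gives \<open>P (insert c (C \<inter> D))\<close>, which then replaces \<open>C\<close>.\<close>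
  have reduce: "P (C' \<inter> D')"
    if meas: "card (C' - D') + card (D' - C') = card (C - D) + card (D - C)"
      and fin: "finite C'" "finite D'" and sub: "C' \<subseteq> A" "D' \<subseteq> A" and P: "P C'" "P D'"
      and c: "c \<in> C' - D'" and big: "C' - D' \<noteq> {c}" for C' D' c
  proof -
    have lt1: "card (C' - insert c D') < card (C' - D')"
      using c fin by (intro psubset_card_mono) auto
    have eq1: "insert c D' - C' = D' - C'" using c by auto
    have "P (insert c D')" using mono[OF P(2), of "insert c D'"] fin sub c by auto
    then have "P (C' \<inter> insert c D')"
      using less.hyps[of C' "insert c D'"] lt1 eq1 meas fin sub P c by auto
    moreover have eq2: "C' \<inter> insert c D' = insert c (C' \<inter> D')" using c by auto
    ultimately have Pc: "P (insert c (C' \<inter> D'))" by simp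
    \<comment> \<open>The left side is \<open>{c}\<close>; the inclusion is proper by
      \<open>big\<close>.\<close>
    have "insert c (C' \<inter> D') - D' \<subset> C' - D'" using c big by auto
    then have lt2: "card (insert c (C' \<inter> D') - D') < card (C' - D')"
      using fin by (intro psubset_card_mono) auto
    have eq3: "D' - insert c (C' \<inter> D') = D' - C'" using c by auto
    have "P (insert c (C' \<inter> D') \<inter> D')"
      using less.hyps[of "insert c (C' \<inter> D')" D'] lt2 eq3 meas fin sub P Pc c by auto
    moreover have "insert c (C' \<inter> D') \<inter> D' = C' \<inter> D'" using c by auto
    ultimately show ?thesis by simp
  qed
  show ?case
  proof (cases "C \<subseteq> D \<or> D \<subseteq> C")
    case True
    then show ?thesis using less.prems by (auto simp: Int_absorb1 Int_absorb2)
  next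
    case False
    then obtain c d where c: "c \<in> C - D" and d: "d \<in> D - C" by blast
    consider "C - D \<noteq> {c}" | "D - C \<noteq> {d}" | "C - D = {c}" "D - C = {d}" by blast
    then show ?thesis
    proof cases
      case 1
      then show ?thesis using reduce[of C D c] less.prems c by simp
    next
      case 2
      \<comment> \<open>The measure is symmetric, so \<open>reduce\<close> also applies with the two
        sets exchanged.\<close>
      then show ?thesis using reduce[of D C d] less.prems d by (simp add: Int_commute)
    next
      case 3
      then have "C = insert c (C \<inter> D)" "D = insert d (C \<inter> D)" by auto
      then have "P (insert c (C \<inter> D))" "P (insert d (C \<inter> D))" using less.prems by simp_all
      then show ?thesis using step[of "C \<inter> D" c d] less.prems c d by auto
    qed
  qed
qed

section \<open>The action on left cosets\<close>

text \<open>Translation by \<open>inv g\<close> inverts translation by \<open>g\<close>. The maps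
  are restricted to \<open>lcosets H\<close> because elements of \<open>BijGroup\<close> are
  extensional.\<close>

lemma (in group) lcosets_group_action:
  assumes H: "subgroup H G"
  shows "group_action G (lcosets H) (\<lambda>g. \<lambda>X \<in> lcosets H. g <# X)"
proof -
  let ?\<phi> = "\<lambda>g. \<lambda>X \<in> lcosets H. g <# X"
  have HG: "H \<subseteq> carrier G" using H by (rule subgroup.subset)
  have sub: "X \<subseteq> carrier G" if "X \<in> lcosets H" for X
    using lcosets_subset_PowG[OF H] that by blast
  have closed: "g <# X \<in> lcosets H" if "g \<in> carrier G" "X \<in> lcosets H" for g X
    using that HG by (auto simp: LCOSETS_def lcos_m_assoc)
  have Bij: "?\<phi> g \<in> Bij (lcosets H)" if g: "g \<in> carrier G" for g
  proof -
    have "bij_betw (?\<phi> g) (lcosets H) (lcosets H)"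
      using g sub closed
      by (intro bij_betw_byWitness[where f' = "?\<phi> (inv g)"])
        (auto simp: lcos_m_assoc lcos_mult_one)
    then show ?thesis by (simp add: Bij_def)
  qed
  have "?\<phi> (g \<otimes> h) = compose (lcosets H) (?\<phi> g) (?\<phi> h)"
    if "g \<in> carrier G" "h \<in> carrier G" for g h
    using that sub closed by (auto simp: compose_def lcos_m_assoc intro!: restrict_ext)
  then have "?\<phi> \<in> hom G (BijGroup (lcosets H))"
    using Bij by (auto simp: hom_def BijGroup_def)
  then show ?thesis
    by (simp add: group_action_def group_hom_def group_hom_axioms_def group_BijGroup is_group)
qed

section \<open>Fixing groups and evaluation of group elements\<close>

lemma fixing_antimono: "C \<subseteq> D \<Longrightarrow> fixing G D \<subseteq> fixing G C"
  by (auto simp: fixing_def)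

lemma supports_iff_fixing_subset_stabilizer:
  "supports DD G \<phi> C x \<longleftrightarrow> C \<subseteq> DD \<and> fixing G C \<subseteq> stabilizer (symmetry_group DD G) \<phi> x"
  by (auto simp: supports_def stabilizer_def symmetry_group_def fixing_def)

locale data_sym =
  fixes DD :: "'d set" and G :: "('d \<Rightarrow> 'd) set"
  assumes data_symmetry: "data_symmetry DD G"
begin

abbreviation S where "S \<equiv> symmetry_group DD G"

lemma carrier_S [simp]: "carrier S = G"
  by (simp add: symmetry_group_def)

lemma G_subgroup: "subgroup G (BijGroup DD)"
  using data_symmetry by (simp add: data_symmetry_def)

sublocale S: group S
  unfolding symmetry_group_def
  by (intro group.subgroup_imp_group[OF group_BijGroup] G_subgroup)

lemma G_Bij: "\<pi> \<in> G \<Longrightarrow> \<pi> \<in> Bij DD"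
  using subgroup.subset[OF G_subgroup] by (auto simp: BijGroup_def)

lemma app_closed: "\<pi> \<in> G \<Longrightarrow> x \<in> DD \<Longrightarrow> \<pi> x \<in> DD"
  using G_Bij Bij_imp_funcset by blast

text \<open>Elements of \<open>BijGroup DD\<close> are \<open>undefined\<close> off
  \<open>DD\<close>, so products, identity and inverses are evaluated only at points of
  \<open>DD\<close>; hence assumptions such as \<open>C \<subseteq> DD\<close> below.\<close>

lemma mult_app: "\<pi> \<in> G \<Longrightarrow> \<sigma> \<in> G \<Longrightarrow> x \<in> DD \<Longrightarrow> (\<pi> \<otimes>\<^bsub>S\<^esub> \<sigma>) x = \<pi> (\<sigma> x)"
  by (simp add: symmetry_group_def BijGroup_def G_Bij compose_def)

lemma one_app: "x \<in> DD \<Longrightarrow> \<one>\<^bsub>S\<^esub> x = x"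
  by (simp add: symmetry_group_def BijGroup_def)

lemma inv_app: "\<pi> \<in> G \<Longrightarrow> x \<in> DD \<Longrightarrow> (inv\<^bsub>S\<^esub> \<pi>) (\<pi> x) = x"
  using mult_app[of "inv\<^bsub>S\<^esub> \<pi>" \<pi> x] S.inv_closed[of \<pi>] S.l_inv[of \<pi>] by (simp add: one_app)

lemma mult_inv_cancel: "g \<in> G \<Longrightarrow> h \<in> G \<Longrightarrow> g \<otimes>\<^bsub>S\<^esub> (inv\<^bsub>S\<^esub> g \<otimes>\<^bsub>S\<^esub> h) = h"
  using S.m_assoc[of g "inv\<^bsub>S\<^esub> g" h] S.inv_closed[of g] S.r_inv[of g] S.l_one[of h] by simp

lemma fixing_subgroup:
  assumes "C \<subseteq> DD"
  shows "subgroup (fixing G C) S"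
proof (rule S.subgroupI)
  show "fixing G C \<subseteq> carrier S" by (auto simp: fixing_def)
  show "fixing G C \<noteq> {}"
    using S.one_closed one_app assms by (auto simp: fixing_def)
  show "inv\<^bsub>S\<^esub> \<pi> \<in> fixing G C" if "\<pi> \<in> fixing G C" for \<pi>
    using that S.inv_closed[of \<pi>] assms inv_app[of \<pi>] by (fastforce simp: fixing_def)
  show "\<pi> \<otimes>\<^bsub>S\<^esub> \<sigma> \<in> fixing G C" if "\<pi> \<in> fixing G C" "\<sigma> \<in> fixing G C" for \<pi> \<sigma>
    using that S.m_closed[of \<pi> \<sigma>] assms by (auto simp: fixing_def mult_app subset_iff)
qed

section \<open>Orbit condition and intersection condition\<close>

text \<open>An orbit-stabilizer argument: \<open>K\<close> and \<open>fixing G E\<close> have the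
  same orbit of \<open>c\<close>, and \<open>K\<close> contains the stabilizer of \<open>c\<close>
  in \<open>fixing G E\<close>, which is \<open>fixing G (E \<union> {c})\<close>. Below,
  \<open>K\<close> is the join.\<close>

lemma fixing_subset_of_orbit_subset:
  assumes K: "subgroup K S" and E: "E \<subseteq> DD" and c: "c \<in> DD"
    and fixK: "fixing G (E \<union> {c}) \<subseteq> K" and KE: "K \<subseteq> fixing G E"
    and orb: "data_orbit c (fixing G E) \<subseteq> data_orbit c K"
  shows "fixing G E \<subseteq> K"
proof
  fix \<pi> assume \<pi>: "\<pi> \<in> fixing G E"
  then obtain \<tau> where \<tau>: "\<tau> \<in> K" "\<pi> c = \<tau> c" using orb by (auto simp: data_orbit_def)
  have GE: "subgroup (fixing G E) S" by (rule fixing_subgroup[OF E])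
  have G: "\<pi> \<in> G" "\<tau> \<in> G" using \<pi> \<tau> KE by (auto simp: fixing_def)
  let ?\<rho> = "inv\<^bsub>S\<^esub> \<tau> \<otimes>\<^bsub>S\<^esub> \<pi>"
  have "?\<rho> \<in> fixing G E"
    using \<pi> \<tau> KE GE by (meson subgroup.m_closed subgroup.m_inv_closed subsetD)
  moreover have "?\<rho> c = c"
    using mult_app[of "inv\<^bsub>S\<^esub> \<tau>" \<pi> c] S.inv_closed[of \<tau>] G c \<tau> inv_app[of \<tau> c] by simp
  ultimately have "?\<rho> \<in> K" using fixK by (auto simp: fixing_def)
  then have "\<tau> \<otimes>\<^bsub>S\<^esub> ?\<rho> \<in> K" using K \<tau>(1) by (rule_tac subgroup.m_closed)
  moreover have "\<tau> \<otimes>\<^bsub>S\<^esub> ?\<rho> = \<pi>" using G by (simp add: mult_inv_cancel)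
  ultimately show "\<pi> \<in> K" by simp
qed

lemma orbit_imp_intersection:
  assumes orbit: "orbit_condition DD G"
  shows "intersection_condition DD G"
  unfolding intersection_condition_def
proof (intro allI impI)
  fix H C D
  assume asm: "subgroup H S \<and> finite C \<and> C \<subseteq> DD \<and> finite D \<and> D \<subseteq> DD \<and>
                fixing G C \<subseteq> H \<and> fixing G D \<subseteq> H"
  show "fixing G (C \<inter> D) \<subseteq> H"
  \<comment> \<open>Upward closure is antitonicity of \<open>fixing\<close>. In the one-point case
    the join \<open>?K\<close> is interposed:
    \<open>fixing G E \<subseteq> ?K \<subseteq> H\<close>.\<close>
  proof (rule Int_closed_from_insert[where P = "\<lambda>C. fixing G C \<subseteq> H" and A = DD])
    fix C D assume "fixing G C \<subseteq> H" "C \<subseteq> D"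
    then show "fixing G D \<subseteq> H" using fixing_antimono by blast
  next
    fix E c d
    assume E: "finite E" "E \<subseteq> DD" and c: "c \<in> DD - E" and d: "d \<in> DD - E" and cd: "c \<noteq> d"
      and Hc: "fixing G (insert c E) \<subseteq> H" and Hd: "fixing G (insert d E) \<subseteq> H"
    let ?U = "fixing G (E \<union> {c}) \<union> fixing G (E \<union> {d})"
    let ?K = "subgroup_join DD G (fixing G (E \<union> {c})) (fixing G (E \<union> {d}))"
    have "?U \<subseteq> fixing G E" using fixing_antimono[of E] by blast
    then have KE: "?K \<subseteq> fixing G E"
      unfolding subgroup_join_def
      by (rule S.generate_subgroup_incl[OF _ fixing_subgroup[OF E(2)]])
    have K: "subgroup ?K S"
      unfolding subgroup_join_def by (rule S.generate_is_subgroup) (auto simp: fixing_def)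
    have "fixing G (E \<union> {c}) \<subseteq> ?K"
      unfolding subgroup_join_def by (auto intro: generate.incl)
    moreover have "data_orbit c (fixing G E) \<subseteq> data_orbit c ?K"
      using orbit E c d cd unfolding orbit_condition_def by blast
    ultimately have "fixing G E \<subseteq> ?K"
      using fixing_subset_of_orbit_subset[OF K E(2)] c KE by blast
    also have "?K \<subseteq> H"
      unfolding subgroup_join_def using asm Hc Hd
      by (intro S.generate_subgroup_incl) auto
    finally show "fixing G E \<subseteq> H" .
  qed (use asm in auto)
qed

text \<open>The join itself serves as the subgroup \<open>H\<close>: it then contains all of
  \<open>fixing G E\<close>, since \<open>c \<noteq> d\<close> makes the two extended sets meet in
  \<open>E\<close>.\<close>

lemma intersection_imp_orbit:
  assumes inter: "intersection_condition DD G"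
  shows "orbit_condition DD G"
  unfolding orbit_condition_def
proof (intro allI impI)
  fix E c d
  assume asm: "finite E \<and> E \<subseteq> DD \<and> c \<in> DD - E \<and> d \<in> DD - E \<and> c \<noteq> d"
  let ?K = "subgroup_join DD G (fixing G (E \<union> {c})) (fixing G (E \<union> {d}))"
  have "subgroup ?K S"
    unfolding subgroup_join_def by (rule S.generate_is_subgroup) (auto simp: fixing_def)
  moreover have "fixing G (E \<union> {c}) \<subseteq> ?K" "fixing G (E \<union> {d}) \<subseteq> ?K"
    unfolding subgroup_join_def by (auto intro: generate.incl)
  ultimately have "fixing G ((E \<union> {c}) \<inter> (E \<union> {d})) \<subseteq> ?K"
    using inter[unfolded intersection_condition_def, rule_format, of ?K "E \<union> {c}" "E \<union> {d}"] asm
    by simp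
  moreover have "(E \<union> {c}) \<inter> (E \<union> {d}) = E" using asm by auto
  ultimately show "data_orbit c (fixing G E) \<subseteq> data_orbit c ?K"
    by (auto simp: data_orbit_def)
qed

section \<open>Intersection condition and least supports\<close>

lemma intersection_imp_least_supports:
  assumes inter: "intersection_condition DD G"
  shows "admits_least_supports TYPE('x) DD G"
  unfolding admits_least_supports_def
proof (intro allI impI ballI)
  fix X :: "'x set" and \<phi> x
  assume nom: "nominal_set DD G X \<phi>" and x: "x \<in> X"
  then have stab: "subgroup (stabilizer S \<phi> x) S"
    unfolding nominal_set_def by (blast intro: group_action.stabilizer_subgroup)
  let ?P = "\<lambda>C. finite C \<and> supports DD G \<phi> C x"
  have "\<exists>C. ?P C" using nom x by (simp add: nominal_set_def)
  \<comment> \<open>A support of minimal cardinality is least: its intersection with any other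
    finite support is again a support, hence cannot be smaller.\<close>
  then obtain C where C: "?P C" and min: "\<And>C'. ?P C' \<Longrightarrow> card C \<le> card C'"
    using ex_has_least_nat[of ?P _ card] by blast
  have "C \<subseteq> C'" if C': "?P C'" for C'
  proof -
    \<comment> \<open>The intersection condition is used for the stabilizer of
      \<open>x\<close>.\<close>
    have "?P (C \<inter> C')"
      using C C' inter stab
      unfolding supports_iff_fixing_subset_stabilizer intersection_condition_def by blast
    then have "card C \<le> card (C \<inter> C')" by (rule min)
    then have "C \<inter> C' = C" using C by (intro card_seteq) auto
    then show ?thesis by blast
  qed
  then show "\<exists>C. least_finite_support DD G \<phi> C x"
    using C unfolding least_finite_support_def by blast
qed

lemma supports_lcoset:
  assumes H: "subgroup H S" and C: "C \<subseteq> DD" "fixing G C \<subseteq> H" and g: "g \<in> G"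
  shows "supports DD G (\<lambda>\<pi>. \<lambda>X \<in> lcosets\<^bsub>S\<^esub> H. \<pi> <#\<^bsub>S\<^esub> X) (g ` C) (g <#\<^bsub>S\<^esub> H)"
  unfolding supports_def
proof (intro conjI ballI)
  show "g ` C \<subseteq> DD" using C g app_closed by blast
  fix \<pi> assume \<pi>: "\<pi> \<in> fixing G (g ` C)"
  then have \<pi>G: "\<pi> \<in> G" by (simp add: fixing_def)
  have HG: "H \<subseteq> G" using subgroup.subset[OF H] by simp
  have ig: "inv\<^bsub>S\<^esub> g \<in> G" using S.inv_closed[of g] g by simp
  have gp: "\<pi> \<otimes>\<^bsub>S\<^esub> g \<in> G" using S.m_closed[of \<pi> g] g \<pi>G by simp
  define \<rho> where "\<rho> = inv\<^bsub>S\<^esub> g \<otimes>\<^bsub>S\<^esub> (\<pi> \<otimes>\<^bsub>S\<^esub> g)"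
  have \<rho>G: "\<rho> \<in> G" using S.m_closed[of "inv\<^bsub>S\<^esub> g" "\<pi> \<otimes>\<^bsub>S\<^esub> g"] ig gp by (simp add: \<rho>_def)
  have "\<rho> c = c" if "c \<in> C" for c
    using that \<pi> C(1) g \<pi>G ig gp by (auto simp: \<rho>_def mult_app inv_app fixing_def subset_iff)
  then have \<rho>H: "\<rho> \<in> H" using C(2) \<rho>G by (auto simp: fixing_def)
  have "\<pi> \<otimes>\<^bsub>S\<^esub> g = g \<otimes>\<^bsub>S\<^esub> \<rho>"
    using g gp by (simp add: \<rho>_def mult_inv_cancel)
  then have "\<pi> <#\<^bsub>S\<^esub> (g <#\<^bsub>S\<^esub> H) = g <#\<^bsub>S\<^esub> (\<rho> <#\<^bsub>S\<^esub> H)"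
    using \<pi>G g HG \<rho>G by (simp add: S.lcos_m_assoc)
  also have "\<rho> <#\<^bsub>S\<^esub> H = H" using S.coset_join3[of \<rho> H] H \<rho>H \<rho>G by simp
  finally show "(\<lambda>X \<in> lcosets\<^bsub>S\<^esub> H. \<pi> <#\<^bsub>S\<^esub> X) (g <#\<^bsub>S\<^esub> H) = g <#\<^bsub>S\<^esub> H"
    using g by (auto simp: LCOSETS_def)
qed

lemma least_supports_imp_intersection:
  assumes least: "admits_least_supports TYPE(('d \<Rightarrow> 'd) set) DD G"
  shows "intersection_condition DD G"
  unfolding intersection_condition_def
proof (intro allI impI)
  fix H C D
  assume asm: "subgroup H S \<and> finite C \<and> C \<subseteq> DD \<and> finite D \<and> D \<subseteq> DD \<and>
                fixing G C \<subseteq> H \<and> fixing G D \<subseteq> H"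
  then have H: "subgroup H S" by simp
  let ?X = "lcosets\<^bsub>S\<^esub> H"
  let ?\<phi> = "\<lambda>\<pi>. \<lambda>X \<in> ?X. \<pi> <#\<^bsub>S\<^esub> X"
  have one: "\<one>\<^bsub>S\<^esub> \<in> G" using S.one_closed by simp
  have oneH: "\<one>\<^bsub>S\<^esub> <#\<^bsub>S\<^esub> H = H" using subgroup.subset[OF H] by (rule S.lcos_mult_one)
  have HX: "H \<in> ?X" using one oneH by (force simp: LCOSETS_def)
  have "\<exists>C. finite C \<and> supports DD G ?\<phi> C Y" if Y: "Y \<in> ?X" for Y
  proof -
    obtain g where g: "g \<in> G" "Y = g <#\<^bsub>S\<^esub> H" using Y by (auto simp: LCOSETS_def)
    then have "supports DD G ?\<phi> (g ` C) Y" using supports_lcoset[OF H] asm by simp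
    then show ?thesis using asm by blast
  qed
  then have "nominal_set DD G ?X ?\<phi>"
    unfolding nominal_set_def using S.lcosets_group_action[OF H] by blast
  then obtain K where K: "least_finite_support DD G ?\<phi> K H"
    using least HX unfolding admits_least_supports_def by blast
  \<comment> \<open>The case \<open>g = 1\<close> of \<open>supports_lcoset\<close>; it makes both
    \<open>C\<close> and \<open>D\<close> supports of the point \<open>H\<close>.\<close>
  have supp: "supports DD G ?\<phi> B H" if "B \<subseteq> DD" "fixing G B \<subseteq> H" for B
  proof -
    have "(\<lambda>x. \<one>\<^bsub>S\<^esub> x) ` B = B" using that(1) by (auto simp: one_app subset_iff image_iff)
    then show ?thesis using supports_lcoset[OF H that one] oneH by simp
  qed
  have "K \<subseteq> C \<inter> D"
    using K asm supp unfolding least_finite_support_def by blast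
  then have "fixing G (C \<inter> D) \<subseteq> fixing G K" by (rule fixing_antimono)
  \<comment> \<open>An element fixing the point \<open>H\<close> lies in \<open>H\<close>, because
    \<open>\<pi>\<close> belongs to its own coset \<open>\<pi>H\<close>.\<close>
  also have "\<dots> \<subseteq> H"
  proof
    fix \<pi> assume \<pi>: "\<pi> \<in> fixing G K"
    then have "\<pi> <#\<^bsub>S\<^esub> H = H"
      using K HX by (auto simp: least_finite_support_def supports_def)
    moreover have "\<pi> \<in> \<pi> <#\<^bsub>S\<^esub> H" using S.lcos_self[of \<pi> H] H \<pi> by (simp add: fixing_def)
    ultimately show "\<pi> \<in> H" by simp
  qed
  finally show "fixing G (C \<inter> D) \<subseteq> H" .
qed

end

text \<open>Cosets of subgroups of \<open>G\<close> have type
  \<open>('d \<Rightarrow> 'd) set\<close>, so least supports over this one type give the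
  intersection condition back. The last conjunct, with \<open>'x\<close> arbitrary, shows that the
  choice of type loses no generality.\<close>

theorem theorem9p3:
  fixes DD :: "'d set" and G :: "('d \<Rightarrow> 'd) set"
  assumes "data_symmetry DD G"
  shows
    "(orbit_condition DD G \<longleftrightarrow> intersection_condition DD G) \<and>
     (intersection_condition DD G \<longleftrightarrow> admits_least_supports TYPE(('d \<Rightarrow> 'd) set) DD G) \<and>
     (intersection_condition DD G \<longrightarrow> admits_least_supports TYPE('x) DD G)"
proof -
  interpret data_sym DD G using assms by unfold_locales
  show ?thesis
    using orbit_imp_intersection intersection_imp_orbit
      intersection_imp_least_supports[where 'x = "('d \<Rightarrow> 'd) set"]
      intersection_imp_least_supports[where 'x = 'x] least_supports_imp_intersection by blast
qed

end
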